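(* Let $d\ge2$ and let $\{Q_j\}_{j=1}^{d^2}$ be an NQPR in dimension $d$. Then its unitary negativity satisfies $$1\le N_{\mathrm U}(\{Q_j\})\le d-\frac{2}{d}.$$ The lower bound is attained if and only if there is a SIC $\{\Pi_j\}_{j=1}^{d^2}$ such that either $Q_j=Q_j^-$ for all $j$ or $Q_j=Q_j^+$ for all $j$.
   Context: An NQPR in dimension $d$ is a family $\{Q_j\}_{j=1}^{d^2}$ of Hermitian operators on $\mathbb{C}^d$ with $\operatorname{tr}(Q_j)=1$ and $\operatorname{tr}(Q_jQ_k)=d\,\delta_{jk}$. For a unitary $U$ on $\mathbb{C}^d$, define the $d^2\times d^2$ matrix $U^Q_{jk}=\operatorname{tr}(Q_jUQ_kU^\dagger)/d$ and the unitary negativity $N_{\mathrm U}(U)=-d\min_{j,k}U^Q_{jk}$; the unitary negativity $N_{\mathrm U}(\{Q_j\})$ of the NQPR is the maximum of $N_{\mathrm U}(U)$ over all unitaries $U$. A SIC in dimension $d$ is a set $\{\Pi_j\}_{j=1}^{d^2}$ of rank-one projectors with $\operatorname{tr}(\Pi_j\Pi_k)=(d\delta_{jk}+1)/(d+1)$; given a SIC, $Q_j^\pm=\mp\sqrt{d+1}\,\Pi_j+\frac{1}{d}(1\pm\sqrt{d+1})$, with $1$ the identity in the operator term. *)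

theory Defs
  imports "Jordan_Normal_Form.Matrix"
begin

text \<open>Operators on C^d are represented as d x d complex matrices (Jordan_Normal_Form).
  Families indexed by j = 1..d^2 in the paper are indexed here by j < d^2.\<close>

definition adj :: "complex mat \<Rightarrow> complex mat" where
  "adj A = mat (dim_col A) (dim_row A) (\<lambda>(i,j). cnj (A $$ (j,i)))"

definition tr :: "complex mat \<Rightarrow> complex" where
  "tr A = (\<Sum>i<dim_row A. A $$ (i,i))"

definition hermitian_op :: "nat \<Rightarrow> complex mat \<Rightarrow> bool" where
  "hermitian_op d A \<longleftrightarrow> A \<in> carrier_mat d d \<and> adj A = A"

definition unitary_op :: "nat \<Rightarrow> complex mat \<Rightarrow> bool" where
  "unitary_op d U \<longleftrightarrow> U \<in> carrier_mat d d \<and> U * adj U = 1\<^sub>m d"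

definition rank_one_projector :: "nat \<Rightarrow> complex mat \<Rightarrow> bool" where
  "rank_one_projector d P \<longleftrightarrow>
     (\<exists>v :: complex vec. dim_vec v = d \<and> (\<Sum>i<d. v $ i * cnj (v $ i)) = 1 \<and>
        P = mat d d (\<lambda>(i,j). v $ i * cnj (v $ j)))"

definition NQPR :: "nat \<Rightarrow> (nat \<Rightarrow> complex mat) \<Rightarrow> bool" where
  "NQPR d Q \<longleftrightarrow>
     (\<forall>j < d^2. hermitian_op d (Q j) \<and> tr (Q j) = 1) \<and>
     (\<forall>j < d^2. \<forall>k < d^2. tr (Q j * Q k) = (if j = k then of_nat d else 0))"

text \<open>U^Q_{jk} = tr(Q_j U Q_k U^dagger)/d; this trace is real (trace of a product of two
  Hermitian matrices), so we take its real part.\<close>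
definition UQ :: "nat \<Rightarrow> (nat \<Rightarrow> complex mat) \<Rightarrow> complex mat \<Rightarrow> nat \<Rightarrow> nat \<Rightarrow> real" where
  "UQ d Q U j k = Re (tr (Q j * U * Q k * adj U)) / real d"

definition NU_unitary :: "nat \<Rightarrow> (nat \<Rightarrow> complex mat) \<Rightarrow> complex mat \<Rightarrow> real" where
  "NU_unitary d Q U = - real d * Min {UQ d Q U j k | j k. j < d^2 \<and> k < d^2}"

text \<open>Unitary negativity of the NQPR: the maximum (here: supremum, which is attained by
  compactness of the unitary group) over all unitaries.\<close>
definition NU :: "nat \<Rightarrow> (nat \<Rightarrow> complex mat) \<Rightarrow> real" where
  "NU d Q = Sup {NU_unitary d Q U | U. unitary_op d U}"

definition SIC :: "nat \<Rightarrow> (nat \<Rightarrow> complex mat) \<Rightarrow> bool" where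
  "SIC d P \<longleftrightarrow>
     (\<forall>j < d^2. rank_one_projector d (P j)) \<and>
     (\<forall>j < d^2. \<forall>k < d^2. tr (P j * P k) =
        (of_nat d * (if j = k then 1 else 0) + 1) / (of_nat d + 1))"

definition Qplus :: "nat \<Rightarrow> (nat \<Rightarrow> complex mat) \<Rightarrow> nat \<Rightarrow> complex mat" where
  "Qplus d P j = (complex_of_real (- sqrt (real d + 1))) \<cdot>\<^sub>m P j +
                 (complex_of_real ((1 + sqrt (real d + 1)) / real d)) \<cdot>\<^sub>m 1\<^sub>m d"

definition Qminus :: "nat \<Rightarrow> (nat \<Rightarrow> complex mat) \<Rightarrow> nat \<Rightarrow> complex mat" where
  "Qminus d P j = (complex_of_real (sqrt (real d + 1))) \<cdot>\<^sub>m P j +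
                  (complex_of_real ((1 - sqrt (real d + 1)) / real d)) \<cdot>\<^sub>m 1\<^sub>m d"

end

theory Submission
  imports Defs "Jordan_Normal_Form.Spectral_Radius"
    "HOL-Combinatorics.Transposition" "HOL-Number_Theory.Cong"
begin

text \<open>Conjugating by unitaries that permute eigenbases, tr(Q_j U Q_k U^dagger) takes all values
  \<open>\<Sum>i. l i * m (\<sigma> i)\<close> with \<open>l\<close>, \<open>m\<close> the eigenvalues of Q_j, Q_k and \<open>\<sigma>\<close> a permutation.
  For j = k, the nontrivial cyclic shifts \<open>\<sigma>\<close> contribute 1 - d in total, because the eigenvalues
  sum to 1 and their squares to d; hence one of the d - 1 shifts gives at most -1, which is the lower
  bound. In case of equality every d-cycle attains the minimum over all permutations, so exchanging
  two values of a d-cycle never decreases the sum; this forces all eigenvalues but one to agree,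
  that is, Q_j = \<open>\<alpha> P + (1 - \<alpha>)/d\<close> with P a rank-one projector and \<open>\<alpha>\<^sup>2 = d + 1\<close>.
  Opposite signs of \<open>\<alpha>\<close> would produce the value 2/d - d < -1 if d > 2, and for d = 2 the sign can be
  chosen freely. The upper bound is the nonnegativity of tr C^2 for C = Q_j + U Q_k U^dagger - 2/d.\<close>

section \<open>Adjoint, trace and unitary operators\<close>

lemma adj_carrier[simp]: "A \<in> carrier_mat n m \<Longrightarrow> adj A \<in> carrier_mat m n"
  by (auto simp: adj_def)

lemma dim_adj[simp]: "dim_row (adj A) = dim_col A" "dim_col (adj A) = dim_row A"
  by (auto simp: adj_def)

lemma index_adj[simp]:
  "i < dim_col A \<Longrightarrow> j < dim_row A \<Longrightarrow> adj A $$ (i,j) = cnj (A $$ (j,i))"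
  by (auto simp: adj_def)

lemma adj_adj[simp]: "adj (adj A) = A"
  by (rule eq_matI) auto

lemma index_mult_sum:
  assumes "A \<in> carrier_mat n m" "B \<in> carrier_mat m p" "i < n" "j < p"
  shows "(A * B) $$ (i,j) = (\<Sum>k<m. A $$ (i,k) * B $$ (k,j))"
  using assms by (auto simp: scalar_prod_def lessThan_atLeast0 intro!: sum.cong)

lemma adj_mult:
  assumes "A \<in> carrier_mat n m" "B \<in> carrier_mat m p"
  shows "adj (A * B) = adj B * adj A"
proof (rule eq_matI)
  fix i j assume "i < dim_row (adj B * adj A)" "j < dim_col (adj B * adj A)"
  then have ij: "i < p" "j < n" using assms by auto
  have "adj (A * B) $$ (i,j) = cnj ((A * B) $$ (j,i))" using assms ij by auto
  also have "\<dots> = (\<Sum>k<m. adj B $$ (i,k) * adj A $$ (k,j))"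
    unfolding index_mult_sum[OF assms ij(2,1)] using assms ij
    by (auto simp: mult.commute intro!: sum.cong)
  also have "\<dots> = (adj B * adj A) $$ (i,j)"
    using assms ij by (subst index_mult_sum[of _ p m _ n]) auto
  finally show "adj (A * B) $$ (i,j) = (adj B * adj A) $$ (i,j)" .
qed (use assms in auto)

lemma adj_one[simp]: "adj (1\<^sub>m n) = 1\<^sub>m n"
  by (rule eq_matI) auto

lemma tr_mult:
  assumes "A \<in> carrier_mat n m" "B \<in> carrier_mat m n"
  shows "tr (A * B) = (\<Sum>i<n. \<Sum>k<m. A $$ (i,k) * B $$ (k,i))"
  unfolding tr_def using assms
  by (auto intro!: sum.cong index_mult_sum[OF assms] simp del: index_mult_mat(1))

lemma tr_mult_commute:
  assumes "A \<in> carrier_mat n m" "B \<in> carrier_mat m n"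
  shows "tr (A * B) = tr (B * A)"
  unfolding tr_mult[OF assms] tr_mult[OF assms(2,1)]
  by (subst sum.swap) (simp add: mult.commute)

lemma tr_one[simp]: "tr (1\<^sub>m n) = of_nat n"
  by (simp add: tr_def)

lemma tr_smult[simp]: "A \<in> carrier_mat n n \<Longrightarrow> tr (c \<cdot>\<^sub>m A) = c * tr A"
  by (auto simp: tr_def sum_distrib_left)

lemma tr_add[simp]: "A \<in> carrier_mat n n \<Longrightarrow> B \<in> carrier_mat n n \<Longrightarrow> tr (A + B) = tr A + tr B"
  by (auto simp: tr_def sum.distrib)

text \<open>\<open>unitary_op\<close> asks for a right inverse only; for square matrices it is a
  left inverse too.\<close>

lemma unitary_op_adj:
  assumes "unitary_op d U" shows "adj U * U = 1\<^sub>m d"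
  using assms unfolding unitary_op_def
  by (auto intro: mat_mult_left_right_inverse[of U d "adj U"])

lemma unitary_op_one: "unitary_op d (1\<^sub>m d)"
  by (auto simp: unitary_op_def)

lemma unitary_op_adjoint: "unitary_op d U \<Longrightarrow> unitary_op d (adj U)"
  using unitary_op_adj[of d U] by (auto simp: unitary_op_def)

lemma mult_adj_cancel:
  assumes "A \<in> carrier_mat n n" "U \<in> carrier_mat n n" "U * adj U = 1\<^sub>m n"
  shows "U * (adj U * A) = A"
  using assms by (subst assoc_mult_mat[of U n n "adj U" n A n, symmetric]) auto

lemma unitary_op_mult:
  assumes "unitary_op d U" "unitary_op d V"
  shows "unitary_op d (U * V)"
proof -
  have c: "U \<in> carrier_mat d d" "V \<in> carrier_mat d d" "U * adj U = 1\<^sub>m d" "V * adj V = 1\<^sub>m d"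
    using assms by (auto simp: unitary_op_def)
  have "U * V * adj (U * V) = U * (V * (adj V * adj U))"
    using c by (simp add: adj_mult[of _ d d _ d] assoc_mult_mat[of _ d d _ d _ d] mult_carrier_mat[of _ d d _ d])
  also have "\<dots> = 1\<^sub>m d"
    using c by (simp add: mult_adj_cancel[where n=d])
  finally show ?thesis using c by (auto simp: unitary_op_def)
qed

section \<open>Real diagonal matrices, Householder reflections and unit eigenvectors\<close>

definition diag_op :: "nat \<Rightarrow> (nat \<Rightarrow> real) \<Rightarrow> complex mat" where
  "diag_op n l = mat n n (\<lambda>(i,j). if i = j then of_real (l i) else 0)"

lemma diag_op_carrier[simp]: "diag_op n l \<in> carrier_mat n n"
  by (auto simp: diag_op_def)

text \<open>The Householder reflection that exchanges the first basis vector e_0 and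
  \<open>v\<close>. A real first entry of \<open>v\<close> makes its coefficient \<open>c\<close>
  real, so that the reflection is Hermitian and an involution at once.\<close>

lemma unit_vector_householder:
  fixes v :: "nat \<Rightarrow> complex" and r :: real
  assumes n: "0 < n" and nv: "(\<Sum>i<n. v i * cnj (v i)) = 1" and r: "v 0 = of_real r"
  obtains W where "W \<in> carrier_mat n n" "adj W = W" "W * W = 1\<^sub>m n"
    "\<And>i. i < n \<Longrightarrow> W $$ (i,0) = v i"
proof (cases "r = 1")
  case True
  \<comment> \<open>A unit vector with first entry 1 equals e_0, so the identity serves; the
    reflection would divide by 1 - r = 0.\<close>
  have "v i = 0" if "i < n" "i \<noteq> 0" for i
  proof -
    have "(\<Sum>i\<in>{..<n}-{0}. v i * cnj (v i)) = 0"
      using nv n r True by (simp add: sum.remove[of _ 0])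
    then have "of_real (\<Sum>i\<in>{..<n}-{0}. (cmod (v i))\<^sup>2) = (0::complex)"
      by (simp add: complex_norm_square del: of_real_power)
    then have "(\<Sum>i\<in>{..<n}-{0}. (cmod (v i))\<^sup>2) = 0"
      unfolding of_real_eq_0_iff .
    then show ?thesis using that by (subst (asm) sum_nonneg_eq_0_iff) auto
  qed
  then show ?thesis using True n r by (intro that[of "1\<^sub>m n"]) auto
next
  case False
  define u where "u i = v i - (if i = 0 then 1 else 0)" for i
  \<comment> \<open>\<open>c\<close> is 2 divided by the squared norm of \<open>u\<close>, because
    that norm squared is 2 (1 - r); this is \<open>nu\<close> below.\<close>
  define c where "c = 1 / complex_of_real (1 - r)"
  have rc: "complex_of_real (1 - r) \<noteq> 0" using False by (simp del: of_real_diff)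
  have split: "{..<n} = insert 0 ({..<n}-{0})" using n by auto
  have "(\<Sum>i<n. u i * cnj (u i)) = (v 0 - 1) * cnj (v 0 - 1) + (\<Sum>i\<in>{..<n}-{0}. v i * cnj (v i))"
    using n by (subst split, subst sum.insert) (auto simp: u_def)
  also have "\<dots> = (v 0 - 1) * cnj (v 0 - 1) + (1 - v 0 * cnj (v 0))"
    using nv n by (simp add: sum.remove[of _ 0] algebra_simps)
  also have "\<dots> = 2 * complex_of_real (1 - r)" unfolding r by (simp add: algebra_simps)
  finally have nu: "c * (\<Sum>i<n. u i * cnj (u i)) = 2" using rc by (simp add: c_def del: of_real_diff)
  define W where "W = mat n n (\<lambda>(i,j). (if i = j then 1 else 0) - c * u i * cnj (u j))"
  have W: "W \<in> carrier_mat n n" by (auto simp: W_def)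
  have "adj W = W"
    by (rule eq_matI) (auto simp: W_def c_def)
  moreover have "W * W = 1\<^sub>m n"
  proof (rule eq_matI)
    fix i j assume "i < dim_row (1\<^sub>m n :: complex mat)" "j < dim_col (1\<^sub>m n :: complex mat)"
    then have ij: "i < n" "j < n" by auto
    have "(W * W) $$ (i,j) = (\<Sum>k<n. W $$ (i,k) * W $$ (k,j))"
      by (rule index_mult_sum[OF W W ij])
    also have "\<dots> = (\<Sum>k<n. (if k = i then (if i = j then 1 else 0) else 0)
        - (if k = i then c * u i * cnj (u j) else 0) - (if k = j then c * u i * cnj (u j) else 0)
        + c * u i * cnj (u j) * (c * (u k * cnj (u k))))"
      using ij by (intro sum.cong) (auto simp: W_def algebra_simps)
    also have "\<dots> = (if i = j then 1 else 0) - c * u i * cnj (u j) - c * u i * cnj (u j)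
       + c * u i * cnj (u j) * (c * (\<Sum>k<n. u k * cnj (u k)))"
      using ij by (simp add: sum.distrib sum_subtractf flip: sum_distrib_left)
    also have "\<dots> = (1\<^sub>m n) $$ (i,j)" unfolding nu using ij by simp
    finally show "(W * W) $$ (i,j) = (1\<^sub>m n) $$ (i,j)" .
  qed (use W in auto)
  moreover have "W $$ (i,0) = v i" if "i < n" for i
  proof -
    have "c * cnj (u 0) = - 1" using rc by (simp add: c_def u_def r field_simps)
    then have "(c * cnj (u 0)) * u i = - u i" by simp
    then have "c * u i * cnj (u 0) = - u i" by (simp only: mult_ac)
    then show ?thesis using that n by (simp add: W_def u_def)
  qed
  ultimately show ?thesis using W that by blast
qed

text \<open>Any eigenvector can be rescaled to norm one and rotated by a phase until its first entry
  is real, as the Householder reflection requires.\<close>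

lemma complex_mat_unit_eigenvector:
  assumes A: "A \<in> carrier_mat n n" and n: "0 < n"
  obtains v k where "v \<in> carrier_vec n" "A *\<^sub>v v = k \<cdot>\<^sub>v v"
    "(\<Sum>i<n. v $ i * cnj (v $ i)) = (1::complex)" "v $ 0 = of_real (cmod (v $ 0))"
proof -
  obtain k w where w: "w \<in> carrier_vec n" "w \<noteq> 0\<^sub>v n" "A *\<^sub>v w = k \<cdot>\<^sub>v w"
    using spectrum_non_empty[OF A] n A
    by (auto simp: spectrum_def eigenvalue_def eigenvector_def)
  define N where "N = (\<Sum>i<n. (cmod (w $ i))\<^sup>2)"
  have "\<exists>i<n. w $ i \<noteq> 0" using w by (metis eq_vecI index_zero_vec carrier_vecD)
  then have N: "N > 0" unfolding N_def
    by (auto intro!: sum_pos2)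
  \<comment> \<open>The phase that turns the first entry into its modulus; if this entry is 0, any
    phase will do and 1 is taken.\<close>
  define p where "p = (if w $ 0 = 0 then 1 else cnj (w $ 0) / cmod (w $ 0))"
  have p: "p * cnj p = 1"
    by (auto simp: p_def norm_divide simp flip: complex_norm_square)
  define s where "s = p / sqrt N"
  have s: "s * cnj s = 1 / of_real N" 
    using p N by (simp add: s_def field_simps flip: of_real_mult)
  define v where "v = s \<cdot>\<^sub>v w"
  have v: "v \<in> carrier_vec n" using w by (simp add: v_def)
  have "A *\<^sub>v v = k \<cdot>\<^sub>v v"
    unfolding v_def using w A by (simp add: mult_mat_vec smult_smult_assoc mult.commute)
  moreover have "(\<Sum>i<n. v $ i * cnj (v $ i)) = (\<Sum>i<n. (s * cnj s) * (w $ i * cnj (w $ i)))"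
    using w by (intro sum.cong) (auto simp: v_def)
  then have "(\<Sum>i<n. v $ i * cnj (v $ i)) = (s * cnj s) * of_real N"
    by (simp add: N_def sum_distrib_left complex_norm_square del: of_real_power)
  then have "(\<Sum>i<n. v $ i * cnj (v $ i)) = 1" using N by (simp add: s)
  moreover have "v $ 0 = of_real (cmod (w $ 0) / sqrt N)"
    using w n by (auto simp: v_def s_def p_def mult.commute[of "cnj (w $ 0)"]
       complex_norm_square[symmetric] power2_eq_square)
  then have "v $ 0 = of_real (cmod (v $ 0))" using N by (simp add: norm_divide)
  ultimately show ?thesis using v that by blast
qed

section \<open>Diagonalization of Hermitian operators\<close>

text \<open>The direct sum of a scalar and a matrix, the block form on which the induction on the
  dimension rests.\<close>

definition bordered_mat :: "complex \<Rightarrow> complex mat \<Rightarrow> complex mat" where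
  "bordered_mat a M = four_block_mat (mat 1 1 (\<lambda>_. a)) (0\<^sub>m 1 (dim_col M)) (0\<^sub>m (dim_row M) 1) M"

lemma bordered_mat_carrier[simp]:
  "M \<in> carrier_mat n n \<Longrightarrow> bordered_mat a M \<in> carrier_mat (Suc n) (Suc n)"
  by (auto simp: bordered_mat_def)

lemma bordered_mat_mult:
  assumes "M \<in> carrier_mat n n" "N \<in> carrier_mat n n"
  shows "bordered_mat a M * bordered_mat b N = bordered_mat (a * b) (M * N)"
proof -
  have "mat 1 1 (\<lambda>_. a) * mat 1 1 (\<lambda>_. b) = mat 1 1 (\<lambda>_. a * b)"
    by (rule eq_matI) (auto simp: scalar_prod_def)
  then show ?thesis
    using assms unfolding bordered_mat_def
    by (subst mult_four_block_mat[of _ 1 1 _ n _ n _ _ 1 _ n])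
       (auto intro!: arg_cong2[where f="\<lambda>x y. four_block_mat x _ _ y"])
qed

lemma adj_bordered_mat:
  "M \<in> carrier_mat n n \<Longrightarrow> adj (bordered_mat a M) = bordered_mat (cnj a) (adj M)"
  by (rule eq_matI) (auto simp: bordered_mat_def)

lemma bordered_mat_one: "bordered_mat 1 (1\<^sub>m n) = 1\<^sub>m (Suc n)"
  by (rule eq_matI) (auto simp: bordered_mat_def)

lemma diag_op_case_nat:
  "diag_op (Suc n) (case_nat a l) = bordered_mat (of_real a) (diag_op n l)"
  by (rule eq_matI) (auto simp: bordered_mat_def diag_op_def split: nat.splits)

text \<open>Spectral theorem by deflation: a reflection with an eigenvector as first column turns
  \<open>A\<close> into a direct sum of an eigenvalue and a smaller Hermitian matrix. That
  \<open>diag_op\<close> takes real entries records that the eigenvalues are real.\<close>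

theorem hermitian_op_diagonalize:
  assumes "hermitian_op n A"
  shows "\<exists>V l. unitary_op n V \<and> A = V * diag_op n l * adj V"
  using assms
proof (induction n arbitrary: A)
  case 0
  then have "A = 1\<^sub>m 0 * diag_op 0 (\<lambda>_. 0) * adj (1\<^sub>m 0)"
    by (intro eq_matI) (auto simp: hermitian_op_def diag_op_def)
  then show ?case using unitary_op_one by blast
next
  case (Suc n)
  let ?n = "Suc n"
  note mc = mult_carrier_mat[of _ ?n ?n _ ?n] and as = assoc_mult_mat[of _ ?n ?n _ ?n _ ?n]
  have A: "A \<in> carrier_mat ?n ?n" "adj A = A" using Suc.prems by (auto simp: hermitian_op_def)
  obtain v k where v: "v \<in> carrier_vec ?n" "A *\<^sub>v v = k \<cdot>\<^sub>v v"
    "(\<Sum>i<?n. v $ i * cnj (v $ i)) = 1" "v $ 0 = of_real (cmod (v $ 0))"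
    using complex_mat_unit_eigenvector[OF A(1)] by blast
  obtain W where W: "W \<in> carrier_mat ?n ?n" "adj W = W" "W * W = 1\<^sub>m ?n"
    "\<And>i. i < ?n \<Longrightarrow> W $$ (i,0) = v $ i"
    using unit_vector_householder[OF _ v(3,4)] by blast
  define B where "B = W * (A * W)"
  have B: "B \<in> carrier_mat ?n ?n" using A W by (simp add: B_def mc)
  have hB: "adj B = B"
    unfolding B_def using A W by (simp add: adj_mult[of _ ?n ?n _ ?n] mc as)
  have AW: "(A * W) $$ (i,0) = k * W $$ (i,0)" if "i < ?n" for i
  proof -
    have "(A * W) $$ (i,0) = (A *\<^sub>v v) $ i"
      using A(1) v(1) W(1,4) that by (auto simp: scalar_prod_def intro!: sum.cong)
    also have "\<dots> = (k \<cdot>\<^sub>v v) $ i" by (simp only: v(2))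
    finally show ?thesis using v(1) W(4) that by simp
  qed
  \<comment> \<open>The first column of \<open>W * A * W\<close> is k times the first column of
    \<open>W * W\<close>, that is, k e_0; Hermiticity then clears the first row and makes k
    real.\<close>
  have B0: "B $$ (i,0) = (if i = 0 then k else 0)" if "i < ?n" for i
  proof -
    have "B $$ (i,0) = (\<Sum>j<?n. W $$ (i,j) * (A * W) $$ (j,0))"
      unfolding B_def by (rule index_mult_sum) (use A W that in \<open>auto simp: mc\<close>)
    also have "\<dots> = (\<Sum>j<?n. k * (W $$ (i,j) * W $$ (j,0)))"
      by (intro sum.cong) (auto simp: AW simp del: index_mult_mat)
    also have "\<dots> = k * (W * W) $$ (i,0)"
      using that by (simp only: index_mult_sum[OF W(1,1)] sum_distrib_left)
    finally show ?thesis using that by (simp add: W(3))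
  qed
  have Bh: "B $$ (i,j) = cnj (B $$ (j,i))" if "i < ?n" "j < ?n" for i j
    using hB B that by (metis index_adj carrier_matD)
  have k: "cnj k = k" "of_real (Re k) = k"
    using Bh[of 0 0] B0[of 0] by (simp_all add: complex_eq_iff)
  define A' where "A' = mat n n (\<lambda>(i,j). B $$ (Suc i, Suc j))"
  have A': "A' \<in> carrier_mat n n" by (simp add: A'_def)
  have "hermitian_op n A'"
    unfolding hermitian_op_def by (auto intro!: eq_matI simp: A'_def Bh[symmetric])
  then obtain V' l where V': "unitary_op n V'" and A'V: "A' = V' * diag_op n l * adj V'"
    using Suc.IH by blast
  have V'c: "V' \<in> carrier_mat n n" "V' * adj V' = 1\<^sub>m n" using V' by (auto simp: unitary_op_def)
  define X where "X = bordered_mat 1 V'"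
  define D where "D = diag_op ?n (case_nat (Re k) l)"
  have X: "X \<in> carrier_mat ?n ?n" "X * adj X = 1\<^sub>m ?n" "D \<in> carrier_mat ?n ?n"
    using V'c by (auto simp: X_def D_def adj_bordered_mat bordered_mat_mult[of _ n] bordered_mat_one)
  have "B = bordered_mat (of_real (Re k)) A'"
    using B B0 Bh[of 0] k
    by (intro eq_matI) (auto simp: bordered_mat_def A'_def)
  also have "\<dots> = X * D * adj X"
    using V'c by (simp add: X_def D_def A'V diag_op_case_nat adj_bordered_mat bordered_mat_mult[of _ n]
        mult_carrier_mat[of _ n n _ n])
  finally have BX: "B = X * D * adj X" .
  have WW: "W * (W * M) = M" if "M \<in> carrier_mat ?n ?n" for M
    using mult_adj_cancel[of M ?n W] W that by simp
  have "A = W * B * W" using A W by (simp add: B_def as mc WW)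
  also have "\<dots> = (W * X) * D * adj (W * X)"
    using W X by (simp add: BX as mc adj_mult[of _ ?n ?n _ ?n])
  finally have "A = (W * X) * D * adj (W * X)" .
  moreover have "unitary_op ?n (W * X)"
    by (rule unitary_op_mult) (use W X in \<open>auto simp: unitary_op_def\<close>)
  ultimately show ?case unfolding D_def by blast
qed

section \<open>Permutation matrices and permuted spectra\<close>

definition perm_op :: "nat \<Rightarrow> (nat \<Rightarrow> nat) \<Rightarrow> complex mat" where
  "perm_op d \<sigma> = mat d d (\<lambda>(i,j). if j = \<sigma> i then 1 else 0)"

lemma perm_op_carrier[simp]: "perm_op d \<sigma> \<in> carrier_mat d d"
  by (auto simp: perm_op_def)

text \<open>Row \<open>i\<close> of \<open>perm_op d \<sigma>\<close> has its 1 in column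
  \<open>\<sigma> i\<close>, so conjugation lists the entries as \<open>m \<circ> \<sigma>\<close>
  and no inverse permutation appears.\<close>

lemma perm_op_conj_diag_op:
  assumes "bij_betw \<sigma> {..<d} {..<d}"
  shows "perm_op d \<sigma> * (diag_op d m * adj (perm_op d \<sigma>)) = diag_op d (m \<circ> \<sigma>)"
proof (rule eq_matI)
  fix i j assume "i < dim_row (diag_op d (m \<circ> \<sigma>))" "j < dim_col (diag_op d (m \<circ> \<sigma>))"
  then have ij: "i < d" "j < d" by (auto simp: diag_op_def)
  have \<sigma>: "\<sigma> i < d" "\<sigma> j < d" "\<sigma> i = \<sigma> j \<longleftrightarrow> i = j"
    using assms ij by (auto simp: bij_betw_def inj_on_def)
  have DP: "(diag_op d m * adj (perm_op d \<sigma>)) $$ (k,j) = (if k = \<sigma> j then of_real (m k) else 0)"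
    if k: "k < d" for k
  proof -
    have "(diag_op d m * adj (perm_op d \<sigma>)) $$ (k,j)
        = (\<Sum>x<d. diag_op d m $$ (k,x) * adj (perm_op d \<sigma>) $$ (x,j))"
      by (rule index_mult_sum) (use ij k in auto)
    also have "\<dots> = (\<Sum>x<d. if x = k then (if k = \<sigma> j then of_real (m k) else 0) else 0)"
      using ij k by (intro sum.cong) (auto simp: diag_op_def perm_op_def)
    finally show ?thesis using k by simp
  qed
  have "(perm_op d \<sigma> * (diag_op d m * adj (perm_op d \<sigma>))) $$ (i,j)
      = (\<Sum>k<d. perm_op d \<sigma> $$ (i,k) * (diag_op d m * adj (perm_op d \<sigma>)) $$ (k,j))"
    by (rule index_mult_sum) (use ij in \<open>auto simp: mult_carrier_mat[of _ d d _ d]\<close>)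
  also have "\<dots> = (\<Sum>k<d. if k = \<sigma> i then (if \<sigma> i = \<sigma> j then of_real (m (\<sigma> i)) else 0) else 0)"
  proof (intro sum.cong refl)
    fix k assume "k \<in> {..<d}"
    then have "k < d" by simp
    then show "perm_op d \<sigma> $$ (i,k) * (diag_op d m * adj (perm_op d \<sigma>)) $$ (k,j)
      = (if k = \<sigma> i then (if \<sigma> i = \<sigma> j then of_real (m (\<sigma> i)) else 0) else 0)"
      unfolding DP[OF \<open>k < d\<close>] using ij by (auto simp: perm_op_def)
  qed
  also have "\<dots> = diag_op d (m \<circ> \<sigma>) $$ (i,j)" using ij \<sigma> by (simp add: diag_op_def)
  finally show "(perm_op d \<sigma> * (diag_op d m * adj (perm_op d \<sigma>))) $$ (i,j)
      = diag_op d (m \<circ> \<sigma>) $$ (i,j)" .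
qed (auto simp: diag_op_def perm_op_def)

lemma diag_op_one: "diag_op d (\<lambda>_. 1) = 1\<^sub>m d"
  by (rule eq_matI) (auto simp: diag_op_def)

lemma unitary_perm_op:
  assumes "bij_betw \<sigma> {..<d} {..<d}" shows "unitary_op d (perm_op d \<sigma>)"
  using perm_op_conj_diag_op[OF assms, of "\<lambda>_. 1"]
  by (simp add: unitary_op_def diag_op_one comp_def left_mult_one_mat[of _ d d])

lemma tr_diag_op: "tr (diag_op d l) = of_real (\<Sum>i<d. l i)"
  by (simp add: tr_def diag_op_def)

lemma tr_diag_op_mult: "tr (diag_op d l * diag_op d m) = of_real (\<Sum>i<d. l i * m i)"
proof -
  have "tr (diag_op d l * diag_op d m) = (\<Sum>i<d. \<Sum>k<d. if k = i then of_real (l i * m i) else 0)"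
    unfolding tr_mult[OF diag_op_carrier diag_op_carrier]
    by (intro sum.cong) (auto simp: diag_op_def)
  then show ?thesis by simp
qed

lemma tr_unitary_conj:
  assumes "unitary_op d V" "A \<in> carrier_mat d d"
  shows "tr (V * A * adj V) = tr A"
proof -
  have V: "V \<in> carrier_mat d d" using assms by (simp add: unitary_op_def)
  have "tr (V * A * adj V) = tr (adj V * (V * A))"
    by (rule tr_mult_commute[of _ d d]) (use V assms in \<open>auto simp: mult_carrier_mat[of _ d d _ d]\<close>)
  also have "adj V * (V * A) = A"
    using mult_adj_cancel[of A d "adj V"] unitary_op_adj[OF assms(1)] V assms by simp
  finally show ?thesis .
qed

text \<open>The witness \<open>V * perm_op d \<sigma> * adj W\<close> carries the eigenbasis of
  \<open>B\<close> to that of \<open>A\<close> up to the permutation; the trace then collapses to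
  one of diagonal matrices.\<close>

lemma exists_unitary_permuting_eigenvalues:
  assumes V: "unitary_op d V" "A = V * diag_op d l * adj V"
    and W: "unitary_op d W" "B = W * diag_op d m * adj W"
    and \<sigma>: "bij_betw \<sigma> {..<d} {..<d}"
  shows "\<exists>U. unitary_op d U \<and> tr (A * U * B * adj U) = of_real (\<Sum>i<d. l i * m (\<sigma> i))"
proof -
  let ?P = "perm_op d \<sigma>" and ?L = "diag_op d l" and ?M = "diag_op d m"
  define U where "U = V * ?P * adj W"
  note mc = mult_carrier_mat[of _ d d _ d] and as = assoc_mult_mat[of _ d d _ d _ d]
    and am = adj_mult[of _ d d _ d]
  have c: "V \<in> carrier_mat d d" "W \<in> carrier_mat d d" using V W by (auto simp: unitary_op_def)
  have U: "unitary_op d U" unfolding U_def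
    by (intro unitary_op_mult unitary_perm_op unitary_op_adjoint V W \<sigma>)
  have cancel: "adj V * (V * X) = X" "adj W * (W * X) = X" if "X \<in> carrier_mat d d" for X
    using mult_adj_cancel[of X d "adj V"] mult_adj_cancel[of X d "adj W"]
      unitary_op_adj[OF V(1)] unitary_op_adj[OF W(1)] c that by auto
  have "A * U * B * adj U = V * (?L * (?P * (?M * adj ?P))) * adj V"
    using c by (simp add: U_def V(2) W(2) as mc am cancel)
  then have "tr (A * U * B * adj U) = tr (?L * (?P * (?M * adj ?P)))"
    by (simp add: tr_unitary_conj[OF V(1)] mc)
  also have "\<dots> = of_real (\<Sum>i<d. l i * m (\<sigma> i))"
    by (simp add: perm_op_conj_diag_op[OF \<sigma>] tr_diag_op_mult)
  finally show ?thesis using U by blast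
qed

section \<open>Correlations of a sequence with its permutations\<close>

lemma bij_betw_shift_mod:
  fixes d k :: nat
  assumes "0 < d" shows "bij_betw (\<lambda>i. (i + k) mod d) {..<d} {..<d}"
proof -
  have "inj_on (\<lambda>i. (i + k) mod d) {..<d}"
    by (rule inj_onI) (metis lessThan_iff mod_less cong_add_rcancel_nat cong_def)
  moreover have "(\<lambda>i. (i + k) mod d) ` {..<d} \<subseteq> {..<d}" using assms by auto
  ultimately show ?thesis by (simp add: bij_betw_def endo_inj_surj)
qed

text \<open>Over all shifts, 0 included, the correlations add up to the square of the sum of
  \<open>l\<close>, which is 1. The shift 0 accounts for d, so the other d - 1 shifts give 1 - d,
  and the added ones balance this.\<close>

lemma sum_cyclic_correlations:
  fixes l :: "nat \<Rightarrow> real"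
  assumes d: "0 < d" and s1: "(\<Sum>i<d. l i) = 1" and s2: "(\<Sum>i<d. l i * l i) = real d"
  shows "(\<Sum>k=1..<d. (\<Sum>i<d. l i * l ((i + k) mod d)) + 1) = 0"
proof -
  have sh: "(\<Sum>k<d. l ((i + k) mod d)) = 1" for i
    using sum.reindex_bij_betw[OF bij_betw_shift_mod[OF d, of i], of l] s1
    by (simp add: add.commute)
  have "(\<Sum>k<d. \<Sum>i<d. l i * l ((i + k) mod d)) = (\<Sum>i<d. l i * (\<Sum>k<d. l ((i + k) mod d)))"
    unfolding sum_distrib_left by (rule sum.swap)
  also have "\<dots> = 1" by (simp add: sh s1)
  finally have "(\<Sum>k<d. \<Sum>i<d. l i * l ((i + k) mod d)) = 1" .
  moreover have "{..<d} = insert 0 {1..<d}" using d by auto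
  moreover have "(\<Sum>i<d. l i * l ((i + 0) mod d)) = real d"
    using s2 by simp
  ultimately have "real d + (\<Sum>k=1..<d. \<Sum>i<d. l i * l ((i + k) mod d)) = 1" by simp
  then show ?thesis using d by (simp add: sum.distrib)
qed

lemma exists_perm_correlation_le:
  fixes l :: "nat \<Rightarrow> real"
  assumes d: "2 \<le> d" and s1: "(\<Sum>i<d. l i) = 1" and s2: "(\<Sum>i<d. l i * l i) = real d"
  shows "\<exists>\<sigma>. bij_betw \<sigma> {..<d} {..<d} \<and> (\<Sum>i<d. l i * l (\<sigma> i)) \<le> -1"
proof (rule ccontr)
  assume "\<not> ?thesis"
  then have "(\<Sum>i<d. l i * l ((i + k) mod d)) + 1 > 0" for k
    using bij_betw_shift_mod[of d k] d by force
  then have "(\<Sum>k=1..<d. (\<Sum>i<d. l i * l ((i + k) mod d)) + 1) > 0"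
    using d by (intro sum_pos) auto
  then show False using sum_cyclic_correlations[OF _ s1 s2] d by simp
qed

text \<open>A cyclic shift attains the minimal correlation, so exchanging two of its values cannot
  lower it; \<open>f\<close> allows the cycle to visit the indices in any order.\<close>

lemma minimal_correlation_exchange:
  fixes l :: "nat \<Rightarrow> real"
  assumes d: "2 \<le> d" and s1: "(\<Sum>i<d. l i) = 1" and s2: "(\<Sum>i<d. l i * l i) = real d"
    and min: "\<And>\<sigma>. bij_betw \<sigma> {..<d} {..<d} \<Longrightarrow> -1 \<le> (\<Sum>i<d. l i * l (\<sigma> i))"
    and f: "bij_betw f {..<d} {..<d}" and ij: "i \<noteq> j" "Suc i < d" "Suc j < d"
  shows "0 \<le> (l (f i) - l (f j)) * (l (f (Suc j)) - l (f (Suc i)))"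
proof -
  define m where "m = l \<circ> f"
  have m1: "(\<Sum>i<d. m i) = 1" and m2: "(\<Sum>i<d. m i * m i) = real d"
    using sum.reindex_bij_betw[OF f, of l] sum.reindex_bij_betw[OF f, of "\<lambda>i. l i * l i"] s1 s2
    by (simp_all add: m_def)
  have mmin: "-1 \<le> (\<Sum>i<d. m i * m (\<sigma> i))" if \<sigma>: "bij_betw \<sigma> {..<d} {..<d}" for \<sigma>
  proof -
    let ?g = "inv_into {..<d} f"
    have g: "bij_betw ?g {..<d} {..<d}" using f by (rule bij_betw_inv_into)
    \<comment> \<open>Conjugating \<open>\<sigma>\<close> by \<open>f\<close> turns a correlation of
      \<open>l \<circ> f\<close> into one of \<open>l\<close>, so the minimality hypothesis carries
      over to \<open>m\<close>.\<close>
    have "bij_betw (f \<circ> \<sigma> \<circ> ?g) {..<d} {..<d}"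
      by (intro bij_betw_trans[OF g] bij_betw_trans[OF \<sigma>] f)
    from min[OF this] have "-1 \<le> (\<Sum>i<d. l i * l (f (\<sigma> (?g i))))" by simp
    also have "\<dots> = (\<Sum>i<d. l (f i) * l (f (\<sigma> (?g (f i)))))"
      by (rule sum.reindex_bij_betw[OF f, symmetric])
    also have "\<dots> = (\<Sum>i<d. m i * m (\<sigma> i))"
      using f by (intro sum.cong) (auto simp: m_def bij_betw_inv_into_left)
    finally show ?thesis .
  qed
  define s where "s i = (i + 1) mod d" for i
  have s: "bij_betw s {..<d} {..<d}" unfolding s_def using d by (intro bij_betw_shift_mod) auto
  have d0: "0 < d" using d by simp
  have "0 \<le> (\<Sum>i<d. m i * m ((i + k) mod d)) + 1" for k
    using mmin[OF bij_betw_shift_mod[OF d0, of k]] by simp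
  \<comment> \<open>Nonnegative terms with sum 0 all vanish; only the shift by 1 is used
    afterwards.\<close>
  then have "\<forall>k\<in>{1..<d}. (\<Sum>i<d. m i * m ((i + k) mod d)) + 1 = 0"
    using sum_cyclic_correlations[OF d0 m1 m2] by (subst sum_nonneg_eq_0_iff[symmetric]) simp_all
  then have eq: "(\<Sum>x<d. m x * m (s x)) = -1" using d by (force simp: s_def)
  let ?t = "transpose i j"
  have "bij_betw ?t {..<d} {..<d}"
    using ij by (intro bij_betw_byWitness[of _ ?t]) (auto simp: transpose_def)
  from mmin[OF bij_betw_trans[OF this s]]
  have ge: "-1 \<le> (\<Sum>x<d. m x * m (s (?t x)))" by simp
  have "0 \<le> (\<Sum>x<d. m x * m (s (?t x)) - m x * m (s x))"
    using eq ge by (simp add: sum_subtractf)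
  \<comment> \<open>The two permutations differ only at the positions \<open>i\<close> and
    \<open>j\<close>.\<close>
  also have "\<dots> = (\<Sum>x\<in>{i,j}. m x * m (s (?t x)) - m x * m (s x))"
    using ij by (intro sum.mono_neutral_right) (auto simp: transpose_def)
  also have "\<dots> = (m i - m j) * (m (s j) - m (s i))"
    using ij by (simp add: algebra_simps)
  finally show ?thesis using ij by (simp add: m_def s_def)
qed

text \<open>Appending the missing indices to the list gives an enumeration of all of them. It serves
  to run a cycle through chosen indices first.\<close>

lemma exists_bij_betw_prefix:
  assumes "distinct xs" "set xs \<subseteq> {..<d}"
  shows "\<exists>f. bij_betw f {..<d} {..<d} \<and> (\<forall>i<length xs. f i = xs ! i)"
proof -
  define ys where "ys = xs @ filter (\<lambda>x. x \<notin> set xs) [0..<d]"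
  have ys: "distinct ys" "set ys = {..<d}" using assms by (auto simp: ys_def)
  then have "length ys = d" by (metis distinct_card card_lessThan)
  then have "bij_betw ((!) ys) {..<d} {..<d}"
    using bij_betw_nth[OF ys(1) refl ys(2)[symmetric]] by simp
  then show ?thesis by (auto simp: ys_def nth_append intro!: exI[of _ "(!) ys"])
qed

text \<open>Exchanges along suitable cycles give two sign conditions: \<open>three\<close> forbids
  three different values, and \<open>four\<close> forbids that two values both occur twice.\<close>

lemma minimal_correlation_constant_off_one_index:
  fixes l :: "nat \<Rightarrow> real"
  assumes d: "2 \<le> d" and s1: "(\<Sum>i<d. l i) = 1" and s2: "(\<Sum>i<d. l i * l i) = real d"
    and min: "\<And>\<sigma>. bij_betw \<sigma> {..<d} {..<d} \<Longrightarrow> -1 \<le> (\<Sum>i<d. l i * l (\<sigma> i))"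
  shows "\<exists>m<d. \<exists>c. \<forall>i<d. i \<noteq> m \<longrightarrow> l i = c"
proof -
  note ex = minimal_correlation_exchange[OF d s1 s2 min]
  \<comment> \<open>The cycle starts with a, b, c, and its values at positions 0 and 1 are
    exchanged: \<open>l b\<close> cannot lie strictly between \<open>l a\<close> and
    \<open>l c\<close>.\<close>
  have three: "0 \<le> (l a - l b) * (l c - l b)" if abc: "distinct [a,b,c]" "a < d" "b < d" "c < d" for a b c
  proof -
    have "card {a,b,c} \<le> card {..<d}" using abc by (intro card_mono) auto
    then have "3 \<le> d" using abc by simp
    moreover obtain f where "bij_betw f {..<d} {..<d}" "\<forall>i<3. f i = [a,b,c] ! i"
      using exists_bij_betw_prefix[OF abc(1), of d] abc(2-) by auto
    ultimately show ?thesis using ex[of f 0 1] by (simp add: numeral_eq_Suc)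
  qed
  \<comment> \<open>Here the cycle starts with a, b, c, e, and the exchange is at positions 0 and
    2.\<close>
  have four: "0 \<le> (l a - l c) * (l e - l b)"
    if abce: "distinct [a,b,c,e]" "a < d" "b < d" "c < d" "e < d" for a b c e
  proof -
    have "card {a,b,c,e} \<le> card {..<d}" using abce by (intro card_mono) auto
    then have "4 \<le> d" using abce by simp
    moreover obtain f where "bij_betw f {..<d} {..<d}" "\<forall>i<4. f i = [a,b,c,e] ! i"
      using exists_bij_betw_prefix[OF abce(1), of d] abce(2-) by auto
    ultimately show ?thesis using ex[of f 0 2] by (simp add: numeral_eq_Suc)
  qed
  show ?thesis
  proof (cases "\<forall>i<d. l i = l 0")
    case True then show ?thesis using d by (metis less_le_trans zero_less_numeral)
  next
    case False
    then obtain i where i: "i < d" "l i \<noteq> l 0" by auto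
    then have i0: "i \<noteq> 0" by metis
    have two: "l x = l 0 \<or> l x = l i" if x: "x < d" for x
    proof (rule ccontr)
      assume n: "\<not> ?thesis"
      then have dist: "x \<noteq> 0" "x \<noteq> i" by metis+
      have "0 \<le> (l 0 - l i) * (l x - l i)" "0 \<le> (l i - l 0) * (l x - l 0)" "0 \<le> (l 0 - l x) * (l i - l x)"
        using three[of 0 i x] three[of i 0 x] three[of 0 x i] x i i0 dist d by auto
      then show False using n i(2) by (auto simp: zero_le_mult_iff)
    qed
    show ?thesis
    proof (cases "\<forall>x<d. x \<noteq> i \<longrightarrow> l x = l 0")
      case True then show ?thesis using i by blast
    next
      case False
      then obtain x where x: "x < d" "x \<noteq> i" "l x \<noteq> l 0" by blast
      then have xi: "l x = l i" "x \<noteq> 0" using two by metis+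
      \<comment> \<open>The value \<open>l i\<close> now occurs at both \<open>i\<close> and
        \<open>x\<close>, so 0 must be the exceptional index: a second index with value
        \<open>l 0\<close> would contradict \<open>four\<close>.\<close>
      have "l y = l i" if y: "y < d" "y \<noteq> 0" for y
      proof (rule ccontr)
        assume "l y \<noteq> l i"
        then have y0: "l y = l 0" "y \<noteq> i" "y \<noteq> x" using two[OF y(1)] xi by metis+
        then have "0 \<le> (l 0 - l i) * (l i - l 0)"
          using four[of 0 y i x] x xi y i i0 d by simp
        then show False using i(2) by (auto simp: zero_le_mult_iff)
      qed
      then show ?thesis using d by (metis less_le_trans zero_less_numeral)
    qed
  qed
qed

section \<open>Bounds on traces of products\<close>

text \<open>This trace is the squared Hilbert-Schmidt norm of \<open>C\<close>.\<close>

lemma Re_tr_adj_mult_nonneg: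
  assumes "C \<in> carrier_mat n m" shows "0 \<le> Re (tr (adj C * C))"
proof -
  have "tr (adj C * C) = (\<Sum>i<m. \<Sum>k<n. of_real ((cmod (C $$ (k,i)))\<^sup>2))"
    unfolding tr_mult[OF adj_carrier[OF assms] assms]
    using assms by (intro sum.cong) (auto simp: complex_norm_square mult.commute simp del: of_real_power)
  then show ?thesis by (simp add: sum_nonneg del: of_real_power)
qed

lemma tr_affine_mult:
  assumes "M \<in> carrier_mat d d" "N \<in> carrier_mat d d"
  shows "tr ((a \<cdot>\<^sub>m M + b \<cdot>\<^sub>m 1\<^sub>m d) * (a' \<cdot>\<^sub>m N + b' \<cdot>\<^sub>m 1\<^sub>m d))
    = a * a' * tr (M * N) + a * b' * tr M + a' * b * tr N + b * b' * of_nat d"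
  using assms
  by (simp add: add_mult_distrib_mat[of _ d d _ _ d] mult_add_distrib_mat[of _ d d _ d]
      mult_smult_distrib[of _ d d _ d] mult_smult_assoc_mat[of _ d d _ d]
      mult_carrier_mat[of _ d d _ d] tr_add[of _ d] tr_smult[of _ d] algebra_simps)

lemma tr_add_square:
  assumes "A \<in> carrier_mat d d" "B \<in> carrier_mat d d"
  shows "tr ((A + B) * (A + B)) = tr (A * A) + tr (B * B) + 2 * tr (A * B)"
  using assms tr_mult_commute[of A d d B]
  by (simp add: add_mult_distrib_mat[of _ d d _ _ d] mult_add_distrib_mat[of _ d d _ d]
      tr_add[of _ d] mult_carrier_mat[of _ d d _ d])

lemma adj_add: "A \<in> carrier_mat n m \<Longrightarrow> B \<in> carrier_mat n m \<Longrightarrow> adj (A + B) = adj A + adj B"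
  by (rule eq_matI) auto

lemma adj_smult: "adj (c \<cdot>\<^sub>m A) = cnj c \<cdot>\<^sub>m adj A"
  by (rule eq_matI) auto

lemma hermitian_op_tr_mult_ge:
  assumes "0 < d" and A: "hermitian_op d A" "tr A = 1" "tr (A * A) = of_nat d"
    and B: "hermitian_op d B" "tr B = 1" "tr (B * B) = of_nat d"
  shows "2 / real d - real d \<le> Re (tr (A * B))"
proof -
  have c: "A \<in> carrier_mat d d" "B \<in> carrier_mat d d" "adj A = A" "adj B = B"
    using A B by (auto simp: hermitian_op_def)
  \<comment> \<open>The shift by 2/d makes \<open>C\<close> traceless and so minimizes the trace of
    its square, which gives the best bound. The factor 1 brings \<open>C\<close> into the shape of
    \<open>tr_affine_mult\<close>.\<close>
  define C where "C = 1 \<cdot>\<^sub>m (A + B) + of_real (- 2 / real d) \<cdot>\<^sub>m 1\<^sub>m d"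
  have C: "C \<in> carrier_mat d d" "adj C = C"
    using c by (auto simp: C_def adj_add[of _ d d] adj_smult)
  have "0 \<le> Re (tr (C * C))" using Re_tr_adj_mult_nonneg[OF C(1)] C(2) by simp
  also have "tr (C * C) = of_real (2 * real d - 4 / real d) + 2 * tr (A * B)"
    unfolding C_def using c A B \<open>0 < d\<close>
    by (subst tr_affine_mult) (simp_all add: tr_add_square tr_add[of _ d] field_simps)
  finally show ?thesis by (simp add: field_simps)
qed

lemma unitary_conj_hermitian_op:
  assumes U: "unitary_op d U" and B: "hermitian_op d B"
  shows "hermitian_op d (U * B * adj U)"
    and "tr (U * B * adj U) = tr B"
    and "(U * B * adj U) * (U * B * adj U) = U * (B * B) * adj U"
proof -
  note mc = mult_carrier_mat[of _ d d _ d] and as = assoc_mult_mat[of _ d d _ d _ d]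
  have c: "U \<in> carrier_mat d d" "B \<in> carrier_mat d d" "adj B = B"
    using U B by (auto simp: unitary_op_def hermitian_op_def)
  show "hermitian_op d (U * B * adj U)"
    using c by (auto simp: hermitian_op_def mc as adj_mult[of _ d d _ d])
  show "tr (U * B * adj U) = tr B" by (rule tr_unitary_conj[OF U c(2)])
  show "(U * B * adj U) * (U * B * adj U) = U * (B * B) * adj U"
    using c unitary_op_adj[OF U]
    by (simp add: as mc mult_adj_cancel[of _ d "adj U", simplified])
qed

lemma mult_unitary_conj_assoc:
  assumes "A \<in> carrier_mat d d" "U \<in> carrier_mat d d" "B \<in> carrier_mat d d"
  shows "A * U * B * adj U = A * (U * B * adj U)"
  using assms by (simp add: assoc_mult_mat[of _ d d _ d _ d] mult_carrier_mat[of _ d d _ d])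

section \<open>Unitary negativity as a supremum of traces\<close>

lemma NU_unitary_ge:
  assumes "0 < d" "j < d^2" "k < d^2"
  shows "- Re (tr (Q j * U * Q k * adj U)) \<le> NU_unitary d Q U"
proof -
  let ?S = "{UQ d Q U j k | j k. j < d^2 \<and> k < d^2}"
  have "?S = (\<lambda>(j,k). UQ d Q U j k) ` ({..<d^2} \<times> {..<d^2})" by auto
  then have "finite ?S" by simp
  then have "Min ?S \<le> UQ d Q U j k" by (rule Min_le) (use assms in auto)
  then have "real d * Min ?S \<le> real d * UQ d Q U j k" using assms by simp
  then show ?thesis using assms by (simp add: NU_unitary_def UQ_def)
qed

lemma NU_unitary_le:
  assumes "0 < d" "\<And>j k. j < d^2 \<Longrightarrow> k < d^2 \<Longrightarrow> - b \<le> Re (tr (Q j * U * Q k * adj U))"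
  shows "NU_unitary d Q U \<le> b"
proof -
  let ?S = "{UQ d Q U j k | j k. j < d^2 \<and> k < d^2}"
  have S: "?S = (\<lambda>(j,k). UQ d Q U j k) ` ({..<d^2} \<times> {..<d^2})" by auto
  have "Min ?S \<in> ?S" unfolding S by (rule Min_in) (use assms(1) in \<open>auto simp: lessThan_empty_iff\<close>)
  then obtain j k where jk: "j < d^2" "k < d^2" "Min ?S = UQ d Q U j k" by auto
  then have "NU_unitary d Q U = - Re (tr (Q j * U * Q k * adj U))"
    using assms(1) by (simp add: NU_unitary_def UQ_def)
  then show ?thesis using assms(2)[OF jk(1,2)] by simp
qed

lemma NU_le:
  assumes "0 < d" "\<And>U j k. unitary_op d U \<Longrightarrow> j < d^2 \<Longrightarrow> k < d^2 \<Longrightarrow>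
      - b \<le> Re (tr (Q j * U * Q k * adj U))"
  shows "NU d Q \<le> b"
  unfolding NU_def using unitary_op_one[of d] NU_unitary_le[OF assms(1)] assms(2)
  by (intro cSup_least) auto

text \<open>Unitary conjugation preserves Hermiticity, the trace and the trace of the square, so the
  bound for a pair of operators applies.\<close>

lemma NQPR_tr_conj_ge:
  assumes d: "0 < d" and Q: "NQPR d Q" and U: "unitary_op d U" and jk: "j < d^2" "k < d^2"
  shows "- (real d - 2 / real d) \<le> Re (tr (Q j * U * Q k * adj U))"
proof -
  have h: "hermitian_op d (Q j)" "tr (Q j) = 1" "tr (Q j * Q j) = of_nat d"
     "hermitian_op d (Q k)" "tr (Q k) = 1" "tr (Q k * Q k) = of_nat d"
    using Q jk by (auto simp: NQPR_def)
  have c: "Q j \<in> carrier_mat d d" "Q k \<in> carrier_mat d d" "U \<in> carrier_mat d d"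
    using h U by (auto simp: hermitian_op_def unitary_op_def)
  note uc = unitary_conj_hermitian_op[OF U h(4)]
  have "2 / real d - real d \<le> Re (tr (Q j * (U * Q k * adj U)))"
    by (rule hermitian_op_tr_mult_ge[OF d h(1-3)])
       (use uc h c in \<open>simp_all add: tr_unitary_conj[OF U] mult_carrier_mat[of _ d d _ d]\<close>)
  then show ?thesis by (simp only: mult_unitary_conj_assoc[OF c(1,3,2)] minus_diff_eq)
qed

text \<open>A real supremum dominates its members only if the set is bounded above; the bound d -
  2/d comes from \<open>NQPR_tr_conj_ge\<close>.\<close>

lemma NU_ge:
  assumes d: "0 < d" and Q: "NQPR d Q" and U: "unitary_op d U" and jk: "j < d^2" "k < d^2"
  shows "- Re (tr (Q j * U * Q k * adj U)) \<le> NU d Q"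
proof -
  have "bdd_above {NU_unitary d Q U | U. unitary_op d U}"
    using NU_unitary_le[OF d NQPR_tr_conj_ge[OF d Q]] by (intro bdd_aboveI) auto
  then have "NU_unitary d Q U \<le> NU d Q"
    unfolding NU_def using U by (intro cSup_upper) auto
  then show ?thesis using NU_unitary_ge[OF d jk] order_trans by blast
qed

section \<open>Rank-one projectors\<close>

lemma rank_one_projectorD:
  assumes "rank_one_projector d P"
  shows "hermitian_op d P" "P * P = P" "tr P = 1"
proof -
  obtain v where v: "(\<Sum>i<d. v $ i * cnj (v $ i)) = 1" "P = mat d d (\<lambda>(i,j). v $ i * cnj (v $ j))"
    using assms by (auto simp: rank_one_projector_def)
  have P: "P \<in> carrier_mat d d" by (simp add: v)
  show "hermitian_op d P"
    by (auto simp: hermitian_op_def v(2) intro!: eq_matI)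
  show "tr P = 1" using v(1) by (simp add: tr_def v(2))
  show "P * P = P"
  proof (rule eq_matI)
    fix i j assume "i < dim_row P" "j < dim_col P"
    then have ij: "i < d" "j < d" using P by auto
    have "(P * P) $$ (i,j) = (\<Sum>k<d. P $$ (i,k) * P $$ (k,j))" by (rule index_mult_sum[OF P P ij])
    also have "\<dots> = (\<Sum>k<d. v $ i * cnj (v $ j) * (v $ k * cnj (v $ k)))"
      using ij by (intro sum.cong) (auto simp: v(2))
    also have "\<dots> = P $$ (i,j)" using ij by (simp add: sum_distrib_left[symmetric] v)
    finally show "(P * P) $$ (i,j) = P $$ (i,j)" .
  qed (use P in auto)
qed

text \<open>By idempotence and cyclicity the trace of P R equals that of
  \<open>adj (P * R) * (P * R)\<close>.\<close>

lemma Re_tr_projector_mult_nonneg: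
  assumes P: "hermitian_op d P" "P * P = P" and R: "hermitian_op d R" "R * R = R"
  shows "0 \<le> Re (tr (P * R))"
proof -
  note mc = mult_carrier_mat[of _ d d _ d] and as = assoc_mult_mat[of _ d d _ d _ d]
  have c: "P \<in> carrier_mat d d" "R \<in> carrier_mat d d" "adj P = P" "adj R = R"
    using P R by (auto simp: hermitian_op_def)
  have "adj (P * R) * (P * R) = R * (P * P * R)"
    using c by (simp add: adj_mult[of _ d d _ d] mc as)
  then have "tr (adj (P * R) * (P * R)) = tr (R * (P * R))" by (simp only: P(2))
  also have "\<dots> = tr (P * R * R)" using c by (intro tr_mult_commute[of _ d d]) (auto simp: mc)
  also have "P * R * R = P * R" using c R(2) by (simp add: as)
  finally show ?thesis using Re_tr_adj_mult_nonneg[of "P * R" d d] c by (simp add: mc)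
qed

section \<open>Unitary negativity of an NQPR\<close>

text \<open>The terms free of the product of projectors add up to
  \<open>(1 - \<alpha>\<^sup>2) / d\<close>, which is -1 for either sign of \<open>\<alpha>\<close>.
  The positive root yields the shape of \<open>Qminus\<close>, the negative one that of
  \<open>Qplus\<close>.\<close>

lemma tr_affine_projectors_unitary_conj:
  assumes d: "0 < d" and P: "P \<in> carrier_mat d d" "tr P = 1" and R: "R \<in> carrier_mat d d" "tr R = 1"
    and U: "unitary_op d U" and \<alpha>: "\<alpha>\<^sup>2 = real d + 1"
    and A: "A = complex_of_real \<alpha> \<cdot>\<^sub>m P + complex_of_real ((1 - \<alpha>) / real d) \<cdot>\<^sub>m 1\<^sub>m d"
    and B: "B = complex_of_real \<alpha> \<cdot>\<^sub>m R + complex_of_real ((1 - \<alpha>) / real d) \<cdot>\<^sub>m 1\<^sub>m d"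
  shows "tr (A * U * B * adj U) = of_real (real d + 1) * tr (P * (U * R * adj U)) - 1"
proof -
  note mc = mult_carrier_mat[of _ d d _ d]
  let ?a = "complex_of_real \<alpha>" and ?b = "complex_of_real ((1 - \<alpha>) / real d)"
  have Uc: "U \<in> carrier_mat d d" "U * adj U = 1\<^sub>m d" using U by (auto simp: unitary_op_def)
  have UB: "U * B * adj U = ?a \<cdot>\<^sub>m (U * R * adj U) + ?b \<cdot>\<^sub>m 1\<^sub>m d"
    using Uc R(1) unfolding B
    by (simp add: add_mult_distrib_mat[of _ d d _ _ d] mult_add_distrib_mat[of _ d d _ d]
      mult_smult_distrib[of _ d d _ d] mult_smult_assoc_mat[of _ d d _ d] mc)
  have "A * U * B * adj U = A * (U * B * adj U)"
    by (rule mult_unitary_conj_assoc) (use P R Uc in \<open>auto simp: A B\<close>)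
  then have "tr (A * U * B * adj U) = ?a * ?a * tr (P * (U * R * adj U)) + ?a * ?b * tr P
      + ?a * ?b * tr (U * R * adj U) + ?b * ?b * of_nat d"
    unfolding UB A by (simp only:, subst tr_affine_mult) (use P R Uc in \<open>auto simp: mc\<close>)
  also have "\<dots> = of_real (\<alpha>\<^sup>2) * tr (P * (U * R * adj U))
      + of_real (2 * \<alpha> * ((1 - \<alpha>) / real d) + ((1 - \<alpha>) / real d)\<^sup>2 * real d)"
    by (simp add: P(2) R(2) tr_unitary_conj[OF U R(1)] power2_eq_square algebra_simps)
  also have "2 * \<alpha> * ((1 - \<alpha>) / real d) + ((1 - \<alpha>) / real d)\<^sup>2 * real d = (1 - \<alpha>\<^sup>2) / real d"
    using d by (simp add: field_simps power2_eq_square)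
  also have "\<dots> = -1" using d \<alpha> by (simp add: field_simps)
  finally show ?thesis by (simp add: \<alpha>)
qed

lemma NU_affine_projectors_le_one:
  assumes d: "0 < d" and P: "\<And>j. j < d^2 \<Longrightarrow> rank_one_projector d (P j)" and \<alpha>: "\<alpha>\<^sup>2 = real d + 1"
    and Q: "\<And>j. j < d^2 \<Longrightarrow>
      Q j = complex_of_real \<alpha> \<cdot>\<^sub>m P j + complex_of_real ((1 - \<alpha>) / real d) \<cdot>\<^sub>m 1\<^sub>m d"
  shows "NU d Q \<le> 1"
proof (rule NU_le[OF d])
  fix U j k assume U: "unitary_op d U" and jk: "j < d^2" "k < d^2"
  note Pj = rank_one_projectorD[OF P[OF jk(1)]] and Pk = rank_one_projectorD[OF P[OF jk(2)]]
  have "0 \<le> Re (tr (P j * (U * P k * adj U)))"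
    by (rule Re_tr_projector_mult_nonneg[OF Pj(1,2)])
       (simp_all add: unitary_conj_hermitian_op[OF U Pk(1)] Pk(2))
  moreover have "tr (Q j * U * Q k * adj U)
      = of_real (real d + 1) * tr (P j * (U * P k * adj U)) - 1"
    by (rule tr_affine_projectors_unitary_conj[OF d _ Pj(3) _ Pk(3) U \<alpha> Q[OF jk(1)] Q[OF jk(2)]])
       (use Pj(1) Pk(1) in \<open>auto simp: hermitian_op_def\<close>)
  ultimately show "- 1 \<le> Re (tr (Q j * U * Q k * adj U))" by (simp del: of_real_add)
qed

section \<open>Operators with a single exceptional eigenvalue\<close>

lemma rank_one_projector_unitary_conj:
  assumes V: "unitary_op d V" and m: "m < d"
  shows "rank_one_projector d (V * diag_op d (\<lambda>i. if i = m then 1 else 0) * adj V)"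
proof -
  let ?D = "diag_op d (\<lambda>i. if i = m then 1 else 0)"
  have c: "V \<in> carrier_mat d d" using V by (simp add: unitary_op_def)
  have VD: "(V * ?D) $$ (i,k) = (if k = m then V $$ (i,m) else 0)" if "i < d" "k < d" for i k
  proof -
    have "(V * ?D) $$ (i,k) = (\<Sum>x<d. V $$ (i,x) * ?D $$ (x,k))"
      by (rule index_mult_sum) (use c that in auto)
    also have "\<dots> = (\<Sum>x<d. if x = m then (if k = m then V $$ (i,m) else 0) else 0)"
      using that by (intro sum.cong) (auto simp: diag_op_def)
    finally show ?thesis using m by simp
  qed
  have "V * ?D * adj V = mat d d (\<lambda>(i,j). V $$ (i,m) * cnj (V $$ (j,m)))" (is "?L = ?R")
  proof (rule eq_matI)
    fix i j assume "i < dim_row ?R" "j < dim_col ?R"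
    then have ij: "i < d" "j < d" by auto
    have "?L $$ (i,j) = (\<Sum>k<d. (V * ?D) $$ (i,k) * adj V $$ (k,j))"
      by (rule index_mult_sum) (use c ij in \<open>auto simp: mult_carrier_mat[of _ d d _ d]\<close>)
    also have "\<dots> = (\<Sum>k<d. if k = m then V $$ (i,m) * cnj (V $$ (j,m)) else 0)"
    proof (intro sum.cong refl)
      fix k assume "k \<in> {..<d}"
      then have k: "k < d" by simp
      show "(V * ?D) $$ (i,k) * adj V $$ (k,j) = (if k = m then V $$ (i,m) * cnj (V $$ (j,m)) else 0)"
        unfolding VD[OF ij(1) k] using k ij c by auto
    qed
    finally show "?L $$ (i,j) = ?R $$ (i,j)" using ij m by simp
  qed (use c in auto)
  \<comment> \<open>The rank-one vector is column \<open>m\<close> of \<open>V\<close>; its norm is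
    a diagonal entry of \<open>adj V * V\<close>, hence 1.\<close>
  moreover have "(\<Sum>i<d. V $$ (i,m) * cnj (V $$ (i,m))) = (adj V * V) $$ (m,m)"
    using c m by (subst index_mult_sum[of _ d d _ d]) (auto simp: mult.commute intro!: sum.cong)
  ultimately show ?thesis unfolding rank_one_projector_def
    using c m by (intro exI[of _ "col V m"]) (auto simp: unitary_op_adj[OF V] intro!: eq_matI)
qed

lemma diag_op_off_one_index:
  assumes V: "unitary_op d V"
  shows "V * diag_op d (\<lambda>i. if i = m then a + b else b) * adj V
    = of_real a \<cdot>\<^sub>m (V * diag_op d (\<lambda>i. if i = m then 1 else 0) * adj V) + of_real b \<cdot>\<^sub>m 1\<^sub>m d"
proof -
  let ?D = "diag_op d (\<lambda>i. if i = m then 1 else 0)"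
  have c: "V \<in> carrier_mat d d" "V * adj V = 1\<^sub>m d" using V by (auto simp: unitary_op_def)
  have "diag_op d (\<lambda>i. if i = m then a + b else b) = of_real a \<cdot>\<^sub>m ?D + of_real b \<cdot>\<^sub>m 1\<^sub>m d"
    by (rule eq_matI) (auto simp: diag_op_def)
  then show ?thesis using c
    by (simp add: add_mult_distrib_mat[of _ d d _ _ d] mult_add_distrib_mat[of _ d d _ d]
      mult_smult_distrib[of _ d d _ d] mult_smult_assoc_mat[of _ d d _ d] mult_carrier_mat[of _ d d _ d])
qed

lemma sum_if_eq_one_index:
  fixes a b :: real
  assumes "m < d" shows "(\<Sum>i<d. if i = m then a else b) = a + (real d - 1) * b"
proof -
  have "(\<Sum>i<d. if i = m then a else b) = (\<Sum>i<d. b + (if i = m then a - b else 0))"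
    by (intro sum.cong) auto
  then show ?thesis using assms by (simp add: sum.distrib algebra_simps)
qed

lemma diag_op_cong: "(\<And>i. i < d \<Longrightarrow> l i = l' i) \<Longrightarrow> diag_op d l = diag_op d l'"
  by (rule eq_matI) (auto simp: diag_op_def)

lemma hermitian_op_unit_tr_spectrum:
  assumes A: "hermitian_op d A" "tr A = 1" "tr (A * A) = of_nat d"
  obtains V l where "unitary_op d V" "A = V * diag_op d l * adj V"
    "(\<Sum>i<d. l i) = 1" "(\<Sum>i<d. l i * l i) = real d"
proof -
  obtain V l where V: "unitary_op d V" and AV: "A = V * diag_op d l * adj V"
    using hermitian_op_diagonalize[OF A(1)] by blast
  have h: "hermitian_op d (diag_op d l)"
    by (auto simp: hermitian_op_def diag_op_def intro!: eq_matI)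
  have "complex_of_real (\<Sum>i<d. l i) = 1"
    using A(2) unfolding AV tr_unitary_conj[OF V diag_op_carrier] tr_diag_op .
  moreover have "tr (A * A) = tr (diag_op d l * diag_op d l)"
    unfolding AV unitary_conj_hermitian_op(3)[OF V h]
    by (rule tr_unitary_conj[OF V]) (simp add: mult_carrier_mat[of _ d d _ d])
  then have "complex_of_real (\<Sum>i<d. l i * l i) = of_real (real d)"
    unfolding tr_diag_op_mult A(3) by simp
  ultimately show ?thesis using that[OF V AV] unfolding of_real_eq_1_iff of_real_eq_iff by blast
qed

text \<open>Minimality passes to all permutation correlations of the spectrum, so all eigenvalues
  but one agree; the two trace conditions then fix \<open>\<alpha>\<close> up to sign. The clause
  for d = 2 settles the sign where both choices describe the same operator.\<close>

lemma extremal_spectrum: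
  assumes d: "2 \<le> d" and A: "hermitian_op d A" "tr A = 1" "tr (A * A) = of_nat d"
    and min: "\<And>U. unitary_op d U \<Longrightarrow> -1 \<le> Re (tr (A * U * A * adj U))"
  shows "\<exists>V m \<alpha>. unitary_op d V \<and> m < d \<and> \<alpha>\<^sup>2 = real d + 1 \<and> (d = 2 \<longrightarrow> 0 < \<alpha>) \<and>
    A = V * diag_op d (\<lambda>i. if i = m then \<alpha> + (1 - \<alpha>) / real d else (1 - \<alpha>) / real d) * adj V"
proof -
  obtain V l where V: "unitary_op d V" "A = V * diag_op d l * adj V"
    and s: "(\<Sum>i<d. l i) = 1" "(\<Sum>i<d. l i * l i) = real d"
    using hermitian_op_unit_tr_spectrum[OF A] by blast
  have "-1 \<le> (\<Sum>i<d. l i * l (\<sigma> i))" if "bij_betw \<sigma> {..<d} {..<d}" for \<sigma>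
    using exists_unitary_permuting_eigenvalues[OF V V that] min by force
  then obtain m c where m: "m < d" and c: "\<And>i. i < d \<Longrightarrow> i \<noteq> m \<Longrightarrow> l i = c"
    using minimal_correlation_constant_off_one_index[OF d s] by metis
  \<comment> \<open>The gap between the exceptional eigenvalue and the common one; it becomes the
    coefficient of the projector.\<close>
  define \<alpha> where "\<alpha> = l m - c"
  have "(\<Sum>i<d. l i) = (\<Sum>i<d. if i = m then \<alpha> + c else c)"
    and "(\<Sum>i<d. l i * l i) = (\<Sum>i<d. if i = m then (\<alpha> + c) * (\<alpha> + c) else c * c)"
    by (intro sum.cong; auto simp: c \<alpha>_def)+
  then have e: "\<alpha> + c + (real d - 1) * c = 1" "(\<alpha> + c) * (\<alpha> + c) + (real d - 1) * (c * c) = real d"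
    using s sum_if_eq_one_index[OF m] by simp_all
  then have \<alpha>: "\<alpha> = 1 - real d * c" by (simp add: algebra_simps)
  then have cc: "c = (1 - \<alpha>) / real d" using d by simp
  \<comment> \<open>The condition on the squares is multiplied by d, so that d c can be replaced by
    \<open>1 - \<alpha>\<close>.\<close>
  have "(real d - 1) * (\<alpha>\<^sup>2 - (real d + 1)) = 0"
  proof -
    have "\<alpha>\<^sup>2 + 2 * \<alpha> * c + real d * c\<^sup>2 = real d"
      using e(2) by (simp add: algebra_simps power2_eq_square)
    then have "real d * \<alpha>\<^sup>2 + 2 * \<alpha> * (real d * c) + (real d * c)\<^sup>2 = real d * real d"
      by (metis (no_types, opaque_lifting) distrib_left mult.assoc mult.left_commute power2_eq_square)
    moreover have dc: "real d * c = 1 - \<alpha>" using \<alpha> by simp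
    ultimately have "real d * \<alpha>\<^sup>2 + 2 * \<alpha> * (1 - \<alpha>) + (1 - \<alpha>)\<^sup>2 = real d * real d"
      by (simp only: dc)
    then show ?thesis by (simp add: algebra_simps power2_eq_square)
  qed
  then have a2: "\<alpha>\<^sup>2 = real d + 1" using d by simp
  have Al: "A = V * diag_op d (\<lambda>i. if i = m then \<alpha> + c else c) * adj V"
    unfolding V(2) using c \<alpha>_def
    by (intro arg_cong[where f="\<lambda>X. V * X * adj V"] diag_op_cong) auto
  show ?thesis
  proof (cases "d = 2 \<and> \<alpha> < 0")
    case False
    have "\<alpha> \<noteq> 0" using a2 by auto
    then show ?thesis using V(1) m a2 Al False unfolding cc by (intro exI[of _ V] exI[of _ m] exI[of _ \<alpha>]) auto
  next
    case True
    \<comment> \<open>In dimension two either eigenvalue may play the role of the exceptional one.\<close>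
    have "A = V * diag_op d (\<lambda>i. if i = 1 - m then - \<alpha> + (1 - - \<alpha>) / real d else (1 - - \<alpha>) / real d) * adj V"
      unfolding Al cc using m True
      by (intro arg_cong[where f="\<lambda>X. V * X * adj V"] diag_op_cong)
         (auto simp: field_simps less_2_cases_iff)
    then show ?thesis using V(1) a2 True by (intro exI[of _ V] exI[of _ "1 - m"] exI[of _ "- \<alpha>"]) auto
  qed
qed

lemma opposite_extremal_spectra:
  assumes d: "2 < d" and V: "unitary_op d V" "unitary_op d W" and m: "m < d" "n < d"
    and \<alpha>: "\<alpha>\<^sup>2 = real d + 1"
    and A: "A = V * diag_op d (\<lambda>i. if i = m then \<alpha> + (1 - \<alpha>) / real d else (1 - \<alpha>) / real d) * adj V"
    and B: "B = W * diag_op d (\<lambda>i. if i = n then - \<alpha> + (1 - - \<alpha>) / real d else (1 - - \<alpha>) / real d) * adj W"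
  shows "\<exists>U. unitary_op d U \<and> Re (tr (A * U * B * adj U)) < -1"
proof -
  \<comment> \<open>The transposition pairs the two exceptional eigenvalues. The resulting sum 2/d -
    d is the least value that \<open>hermitian_op_tr_mult_ge\<close> allows, and it lies strictly
    below -1 once d > 2.\<close>
  let ?t = "transpose m n" and ?b = "(1 - \<alpha>) / real d" and ?c = "(1 - - \<alpha>) / real d"
  have "bij_betw ?t {..<d} {..<d}"
    using m by (intro bij_betw_byWitness[of _ ?t]) (auto simp: transpose_def)
  from exists_unitary_permuting_eigenvalues[OF V(1) A V(2) B this]
  obtain U where U: "unitary_op d U" "tr (A * U * B * adj U) = of_real (\<Sum>i<d.
     (if i = m then \<alpha> + ?b else ?b) * (if ?t i = n then - \<alpha> + ?c else ?c))" by blast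
  have "(\<Sum>i<d. (if i = m then \<alpha> + ?b else ?b) * (if ?t i = n then - \<alpha> + ?c else ?c))
    = (\<Sum>i<d. if i = m then (\<alpha> + ?b) * (- \<alpha> + ?c) else ?b * ?c)"
    by (intro sum.cong refl) (auto simp: transpose_def)
  also have "\<dots> = (\<alpha> + ?b) * (- \<alpha> + ?c) + (real d - 1) * (?b * ?c)"
    by (rule sum_if_eq_one_index[OF m(1)])
  also have "\<dots> = (1 + \<alpha>\<^sup>2) / real d - \<alpha>\<^sup>2" using d by (simp add: field_simps power2_eq_square)
  also have "\<dots> = 2 / real d - real d" unfolding \<alpha> using d by (simp add: field_simps)
  also have "\<dots> < -1"
  proof -
    have "2 / real d < 1" using d by simp
    then show ?thesis using d by linarith
  qed
  finally show ?thesis using U by auto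
qed

section \<open>The lower bound and its equality case\<close>

lemma NQPR_NU_ge_one:
  assumes d: "2 \<le> d" and Q: "NQPR d Q"
  shows "1 \<le> NU d Q"
proof -
  have 0: "0 < d^2" "0 < d" using d by auto
  have "hermitian_op d (Q 0)" "tr (Q 0) = 1" "tr (Q 0 * Q 0) = of_nat d"
    using Q 0 by (auto simp: NQPR_def)
  then obtain V l where V: "unitary_op d V" "Q 0 = V * diag_op d l * adj V"
    and s: "(\<Sum>i<d. l i) = 1" "(\<Sum>i<d. l i * l i) = real d"
    by (rule hermitian_op_unit_tr_spectrum)
  \<comment> \<open>One operator paired with itself already reaches negativity 1.\<close>
  obtain \<sigma> where \<sigma>: "bij_betw \<sigma> {..<d} {..<d}" "(\<Sum>i<d. l i * l (\<sigma> i)) \<le> -1"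
    using exists_perm_correlation_le[OF d s] by blast
  obtain U where U: "unitary_op d U" "tr (Q 0 * U * Q 0 * adj U) = of_real (\<Sum>i<d. l i * l (\<sigma> i))"
    using exists_unitary_permuting_eigenvalues[OF V V \<sigma>(1)] by blast
  show ?thesis using NU_ge[OF 0(2) Q U(1) 0(1) 0(1)] \<sigma>(2) unfolding U(2) by simp
qed

lemma NQPR_NU_eq_one_imp_affine_projectors:
  assumes d: "2 \<le> d" and Q: "NQPR d Q" and N: "NU d Q = 1"
  shows "\<exists>P \<alpha>. \<alpha>\<^sup>2 = real d + 1 \<and> (\<forall>j<d^2. rank_one_projector d (P j) \<and>
      Q j = complex_of_real \<alpha> \<cdot>\<^sub>m P j + complex_of_real ((1 - \<alpha>) / real d) \<cdot>\<^sub>m 1\<^sub>m d)"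
proof -
  have d0: "0 < d" "0 < d^2" using d by auto
  have ge: "-1 \<le> Re (tr (Q j * U * Q k * adj U))" if "unitary_op d U" "j < d^2" "k < d^2" for U j k
    using NU_ge[OF d0(1) Q that] N by simp
  define S where "S j V m \<alpha> \<longleftrightarrow> unitary_op d V \<and> m < d \<and> \<alpha>\<^sup>2 = real d + 1 \<and> (d = 2 \<longrightarrow> 0 < \<alpha>) \<and>
    Q j = V * diag_op d (\<lambda>i. if i = m then \<alpha> + (1 - \<alpha>) / real d else (1 - \<alpha>) / real d) * adj V"
    for j V m \<alpha>
  have "\<exists>V m \<alpha>. S j V m \<alpha>" if j: "j < d^2" for j
    unfolding S_def by (rule extremal_spectrum[OF d]) (use Q j ge in \<open>auto simp: NQPR_def\<close>)
  then obtain V m \<alpha> where S: "\<And>j. j < d^2 \<Longrightarrow> S j (V j) (m j) (\<alpha> j)" by metis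
  \<comment> \<open>All signs are compared with that at index 0. For d = 2 both are positive by the
    choice in \<open>S\<close>; for larger d a disagreement would push a trace below -1.\<close>
  have \<alpha>: "\<alpha> j = \<alpha> 0" if j: "j < d^2" for j
  proof (rule ccontr)
    assume ne: "\<alpha> j \<noteq> \<alpha> 0"
    have "(\<alpha> j)\<^sup>2 = (\<alpha> 0)\<^sup>2" using S[OF j] S[OF d0(2)] by (simp add: S_def)
    then have op: "\<alpha> j = - \<alpha> 0" using ne by (auto simp: power2_eq_iff)
    then have "d \<noteq> 2" using S[OF j] S[OF d0(2)] by (auto simp: S_def)
    then have d2: "2 < d" using d by simp
    obtain U where U: "unitary_op d U" "Re (tr (Q 0 * U * Q j * adj U)) < -1"
      using opposite_extremal_spectra[OF d2, of "V 0" "V j" "m 0" "m j" "\<alpha> 0" "Q 0" "Q j"]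
        S[OF j] S[OF d0(2)] unfolding S_def op by blast
    then show False using ge[OF U(1) d0(2) j] by simp
  qed
  define P where "P j = V j * diag_op d (\<lambda>i. if i = m j then 1 else 0) * adj (V j)" for j
  have "rank_one_projector d (P j)" if "j < d^2" for j
    unfolding P_def using S[OF that] by (intro rank_one_projector_unitary_conj) (auto simp: S_def)
  moreover have "Q j = of_real (\<alpha> 0) \<cdot>\<^sub>m P j + of_real ((1 - \<alpha> 0) / real d) \<cdot>\<^sub>m 1\<^sub>m d"
    if j: "j < d^2" for j
  proof -
    have V: "unitary_op d (V j)" and Qj: "Q j = V j * diag_op d (\<lambda>i. if i = m j
        then \<alpha> 0 + (1 - \<alpha> 0) / real d else (1 - \<alpha> 0) / real d) * adj (V j)"
      using S[OF j] unfolding S_def \<alpha>[OF j] by blast+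
    show ?thesis unfolding Qj P_def by (rule diag_op_off_one_index[OF V])
  qed
  moreover have "(\<alpha> 0)\<^sup>2 = real d + 1" using S[OF d0(2)] by (simp add: S_def)
  ultimately show ?thesis by blast
qed

lemma NQPR_affine_projectors_SIC:
  assumes d: "0 < d" and Q: "NQPR d Q" and \<alpha>: "\<alpha>\<^sup>2 = real d + 1"
    and P: "\<And>j. j < d^2 \<Longrightarrow> rank_one_projector d (P j)"
    and QP: "\<And>j. j < d^2 \<Longrightarrow>
      Q j = complex_of_real \<alpha> \<cdot>\<^sub>m P j + complex_of_real ((1 - \<alpha>) / real d) \<cdot>\<^sub>m 1\<^sub>m d"
  shows "SIC d P"
  unfolding SIC_def
proof (intro conjI allI impI)
  fix j k assume jk: "j < d^2" "k < d^2"
  note Pj = rank_one_projectorD[OF P[OF jk(1)]] and Pk = rank_one_projectorD[OF P[OF jk(2)]]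
  have c: "P j \<in> carrier_mat d d" "P k \<in> carrier_mat d d" "Q j \<in> carrier_mat d d" "Q k \<in> carrier_mat d d"
    using Pj(1) Pk(1) Q jk by (auto simp: hermitian_op_def NQPR_def)
  \<comment> \<open>The identity is taken as the unitary; orthogonality of the \<open>Q j\<close>
    then turns into the overlap condition of a SIC.\<close>
  have "tr (Q j * Q k) = of_real (real d + 1) * tr (P j * P k) - 1"
    using tr_affine_projectors_unitary_conj[OF d c(1) Pj(3) c(2) Pk(3) unitary_op_one \<alpha> QP[OF jk(1)] QP[OF jk(2)]] c
    by (simp add: mult_carrier_mat[of _ d d _ d] right_mult_one_mat[of _ d d] left_mult_one_mat[of _ d d])
  moreover have "tr (Q j * Q k) = (if j = k then of_nat d else 0)" using Q jk by (auto simp: NQPR_def)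
  ultimately have "(of_nat d + 1) * tr (P j * P k) = of_nat d * (if j = k then 1 else 0) + 1"
    by (auto simp: algebra_simps)
  moreover have "(of_nat d + 1 :: complex) \<noteq> 0" by (metis of_nat_Suc of_nat_eq_0_iff add.commute nat.distinct(1))
  ultimately show "tr (P j * P k) = (of_nat d * (if j = k then 1 else 0) + 1) / (of_nat d + 1)"
    by (simp add: field_simps)
qed (rule P)

theorem theorem3:
  fixes d :: nat and Q :: "nat \<Rightarrow> complex mat"
  assumes "d \<ge> 2" and "NQPR d Q"
  shows "1 \<le> NU d Q \<and> NU d Q \<le> real d - 2 / real d \<and>
         (NU d Q = 1 \<longleftrightarrow>
            (\<exists>P. SIC d P \<and> ((\<forall>j < d^2. Q j = Qminus d P j) \<or> (\<forall>j < d^2. Q j = Qplus d P j))))"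
proof (intro conjI iffI)
  have d: "0 < d" using assms(1) by simp
  let ?s = "sqrt (real d + 1)"
  have s2: "?s\<^sup>2 = real d + 1" "(- ?s)\<^sup>2 = real d + 1" by simp_all
  show ge: "1 \<le> NU d Q" by (rule NQPR_NU_ge_one[OF assms])
  show "NU d Q \<le> real d - 2 / real d" by (rule NU_le[OF d NQPR_tr_conj_ge[OF d assms(2)]])
  {
    assume "NU d Q = 1"
    then obtain P \<alpha> where \<alpha>: "\<alpha>\<^sup>2 = real d + 1" and P: "\<And>j. j < d^2 \<Longrightarrow> rank_one_projector d (P j)"
      and QP: "\<And>j. j < d^2 \<Longrightarrow>
        Q j = complex_of_real \<alpha> \<cdot>\<^sub>m P j + complex_of_real ((1 - \<alpha>) / real d) \<cdot>\<^sub>m 1\<^sub>m d"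
      using NQPR_NU_eq_one_imp_affine_projectors[OF assms] by blast
    have "SIC d P" by (rule NQPR_affine_projectors_SIC[OF d assms(2) \<alpha> P QP])
    \<comment> \<open>The two roots correspond to \<open>Qminus\<close> and \<open>Qplus\<close>, in
      this order.\<close>
    moreover have "\<alpha> = ?s \<or> \<alpha> = - ?s" using \<alpha> s2(1) by (metis power2_eq_iff)
    then have "(\<forall>j < d^2. Q j = Qminus d P j) \<or> (\<forall>j < d^2. Q j = Qplus d P j)"
      using QP by (auto simp: Qminus_def Qplus_def)
    ultimately show "\<exists>P. SIC d P \<and> ((\<forall>j < d^2. Q j = Qminus d P j) \<or> (\<forall>j < d^2. Q j = Qplus d P j))"
      by blast
  next
    assume "\<exists>P. SIC d P \<and> ((\<forall>j < d^2. Q j = Qminus d P j) \<or> (\<forall>j < d^2. Q j = Qplus d P j))"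
    then obtain P where S: "SIC d P"
      and QP: "(\<forall>j < d^2. Q j = Qminus d P j) \<or> (\<forall>j < d^2. Q j = Qplus d P j)" by blast
    have P: "\<And>j. j < d^2 \<Longrightarrow> rank_one_projector d (P j)" using S by (simp add: SIC_def)
    have "NU d Q \<le> 1" using QP
    proof
      assume "\<forall>j < d^2. Q j = Qminus d P j"
      then show ?thesis using NU_affine_projectors_le_one[OF d P s2(1)] by (simp add: Qminus_def)
    next
      assume "\<forall>j < d^2. Q j = Qplus d P j"
      then show ?thesis using NU_affine_projectors_le_one[OF d P s2(2)] by (simp add: Qplus_def)
    qed
    then show "NU d Q = 1" using ge by simp
  }
qed

end
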